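(* Let $p\ge 2$ be an integer, and let $\rho$ be the unique positive real number such that the probability distribution $\psi_\rho$ on $[p]=\{0,1,\ldots,p-1\}$ given by $$\psi_\rho(j)=\frac{\rho^j}{1+\rho+\cdots+\rho^{p-1}},\qquad 0\le j\le p-1,$$ has expected value $\frac{p-1}{3}$. Then $\psi_\rho\in\Delta_p$.
   Context: $\Delta_p$ denotes the set of probability distributions $\pi$ on $[p]=\{0,1,\ldots,p-1\}$ for which there exist (in general dependent) random variables $X_1,X_2,X_3$ on a common probability space, each distributed according to $\pi$, such that $X_1+X_2+X_3$ is constant equal to $p-1$. *)

theory Defs
  imports "HOL-Probability.Probability"
begin

text \<open>
  A definition cannot quantify existentially over the type of the sample space, so it is fixed
  to be the type of triples of naturals. This loses no generality: by \<open>Delta_I\<close> below,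
  random variables on a probability space of any type (with the sum constant even only almost
  surely) can be replaced by the coordinates under their joint law.
\<close>

definition Delta :: "nat \<Rightarrow> nat pmf set" where
  "Delta p = {\<pi>. set_pmf \<pi> \<subseteq> {..<p} \<and>
     (\<exists>(M :: (nat \<times> nat \<times> nat) measure) X1 X2 X3.
        prob_space M \<and>
        (\<forall>X\<in>{X1, X2, X3}. X \<in> measurable M (count_space UNIV) \<and>
           distr M (count_space UNIV) X = measure_pmf \<pi>) \<and>
        (\<forall>\<omega>\<in>space M. X1 \<omega> + X2 \<omega> + X3 \<omega> = p - 1))}"

definition psi :: "nat \<Rightarrow> real \<Rightarrow> nat pmf" where
  "psi p \<rho> = embed_pmf (\<lambda>j. if j < p then \<rho> ^ j / (\<Sum>i<p. \<rho> ^ i) else 0)"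

text \<open>The function embedded in \<open>psi\<close> is a probability mass function whenever
  \<open>\<rho> > 0\<close> and \<open>p > 0\<close>.\<close>

lemma pmf_psi:
  assumes "\<rho> > 0" "p > 0"
  shows "pmf (psi p \<rho>) j = (if j < p then \<rho> ^ j / (\<Sum>i<p. \<rho> ^ i) else 0)"
proof -
  let ?S = "\<Sum>i<p. \<rho> ^ i"
  let ?f = "\<lambda>j. if j < p then \<rho> ^ j / ?S else 0"
  have S: "?S > 0" using assms by (intro sum_pos) auto
  have nn: "?f j \<ge> 0" for j using S assms by auto
  have "(\<integral>\<^sup>+ j. ennreal (?f j) \<partial>count_space UNIV) =
        (\<integral>\<^sup>+ j. ennreal (?f j) \<partial>count_space {..<p})"
    by (intro nn_integral_count_space_eq) auto
  also have "\<dots> = (\<Sum>j<p. ennreal (?f j))"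
    by (simp add: nn_integral_count_space_finite)
  also have "\<dots> = ennreal (\<Sum>j<p. ?f j)"
    by (rule sum_ennreal) (rule nn)
  also have "(\<Sum>j<p. ?f j) = (\<Sum>j<p. \<rho> ^ j) / ?S"
    unfolding sum_divide_distrib by (intro sum.cong) auto
  also have "\<dots> = 1" using S by simp
  finally have one: "(\<integral>\<^sup>+ j. ennreal (?f j) \<partial>count_space UNIV) = 1" by simp
  show ?thesis unfolding psi_def by (rule pmf_embed_pmf[OF nn one])
qed

lemma Delta_I:
  fixes M :: "'a measure" and X1 X2 X3 :: "'a \<Rightarrow> nat"
  assumes sub: "set_pmf \<pi> \<subseteq> {..<p}" and M: "prob_space M"
    and meas: "\<And>X. X \<in> {X1, X2, X3} \<Longrightarrow> X \<in> measurable M (count_space UNIV)"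
    and law: "\<And>X. X \<in> {X1, X2, X3} \<Longrightarrow>
      distr M (count_space UNIV) X = measure_pmf \<pi>"
    and sum: "AE \<omega> in M. X1 \<omega> + X2 \<omega> + X3 \<omega> = p - 1"
  shows "\<pi> \<in> Delta p"
proof -
  interpret prob_space M by fact
  define Y where "Y = (\<lambda>\<omega>. (X1 \<omega>, X2 \<omega>, X3 \<omega>))"
  define T where "T = {(a :: nat, b :: nat, c :: nat). a + b + c = p - 1}"
  define Z where "Z = (\<lambda>\<omega>. if Y \<omega> \<in> T then Y \<omega> else (p - 1, 0, 0))"
  define N where "N = distr M (count_space T) Z"
  have mX [measurable]: "X1 \<in> measurable M (count_space UNIV)"
    "X2 \<in> measurable M (count_space UNIV)" "X3 \<in> measurable M (count_space UNIV)"
    using meas by auto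
  have mY [measurable]: "Y \<in> measurable M (count_space UNIV)"
  proof -
    have "(\<lambda>\<omega>. (X1 \<omega>, X2 \<omega>, X3 \<omega>)) \<in>
      measurable M (count_space UNIV \<Otimes>\<^sub>M (count_space UNIV \<Otimes>\<^sub>M count_space UNIV))"
      by measurable
    then show ?thesis
      by (simp add: Y_def pair_measure_countable)
  qed
  have mZ0: "Z \<in> measurable M (count_space UNIV)"
    unfolding Z_def using mY by measurable
  have ZT: "Z \<omega> \<in> T" for \<omega> by (auto simp: Z_def T_def)
  have mZ: "Z \<in> measurable M (count_space T)"
  proof (rule measurableI)
    fix A assume "A \<in> sets (count_space T)"
    show "Z -` A \<inter> space M \<in> sets M"
      by (rule measurable_sets[OF mZ0]) simp
  qed (use ZT in auto)
  have ae: "AE \<omega> in M. Z \<omega> = Y \<omega>"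
    using sum by eventually_elim (auto simp: Z_def Y_def T_def)
  have pN: "prob_space N" unfolding N_def by (rule prob_space_distr[OF mZ])
  have key: "g \<in> measurable N (count_space UNIV) \<and>
      distr N (count_space UNIV) g = measure_pmf \<pi>"
    if X: "X \<in> {X1, X2, X3}" and g: "\<And>\<omega>. g (Y \<omega>) = X \<omega>"
    for X and g :: "nat \<times> nat \<times> nat \<Rightarrow> nat"
  proof
    have mg: "g \<in> measurable (count_space T) (count_space UNIV)" by simp
    show "g \<in> measurable N (count_space UNIV)"
      by (simp add: N_def)
    have "distr N (count_space UNIV) g = distr M (count_space UNIV) (g \<circ> Z)"
      unfolding N_def by (rule distr_distr[OF mg mZ])
    also have "\<dots> = distr M (count_space UNIV) X"
    proof (rule distr_cong_AE)
      show "AE \<omega> in M. (g \<circ> Z) \<omega> = X \<omega>"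
        using ae by eventually_elim (simp add: g)
      show "g \<circ> Z \<in> measurable M (count_space UNIV)"
        by (rule measurable_comp[OF mZ mg])
      show "X \<in> measurable M (count_space UNIV)" using meas X by simp
    qed auto
    also have "\<dots> = measure_pmf \<pi>" using law X by simp
    finally show "distr N (count_space UNIV) g = measure_pmf \<pi>" .
  qed
  have k1: "fst \<in> measurable N (count_space UNIV) \<and>
      distr N (count_space UNIV) fst = measure_pmf \<pi>"
    by (rule key[of X1]) (auto simp: Y_def)
  have k2: "(fst \<circ> snd) \<in> measurable N (count_space UNIV) \<and>
      distr N (count_space UNIV) (fst \<circ> snd) = measure_pmf \<pi>"
    by (rule key[of X2]) (auto simp: Y_def)
  have k3: "(snd \<circ> snd) \<in> measurable N (count_space UNIV) \<and>
      distr N (count_space UNIV) (snd \<circ> snd) = measure_pmf \<pi>"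
    by (rule key[of X3]) (auto simp: Y_def)
  have "\<forall>\<omega>\<in>space N. fst \<omega> + (fst \<circ> snd) \<omega> + (snd \<circ> snd) \<omega> = p - 1"
    by (auto simp: N_def T_def)
  with k1 k2 k3 pN sub show ?thesis
    unfolding Delta_def by blast
qed

end

(*
  By duality it suffices that psi pairs nonnegatively with every f on {0..n}, n = p - 1, such that
  f a + f b + f c >= 0 whenever a + b + c = n.  Uniform distributions on three intervals whose
  lengths satisfy the triangle inequality and whose means add up to n can be coupled with constant
  sum n: the squares of the Wigner 3j symbols are such a coupling.  Hence f has a nonnegative sum
  of averages over any three such intervals.  This forces some tilt f j + beta * (3 * j - n) to have
  nonnegative partial sums, and psi, being decreasing with mean n / 3, pairs nonnegatively with the
  tilt and does not see beta.
*)

theory Submission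
  imports Defs
begin

text \<open>No closed formula for the 3j symbols is used. An invariant vector of three irreducible
  representations of SL2 is built as a product of brackets, and its squared coefficients have
  uniform marginals for the reason behind Schur's lemma: it amounts to an equivariant map out of an
  irreducible factor, which is a multiple of an isometry. Partial sums enter because decreasing
  nonnegative weights are nonnegative combinations of indicators of initial segments. The mean
  condition contributes the one multiplier beta. The obstacle is that initial segments alone do not
  give enough couplings: intervals with a positive left end are needed. They are harmless because
  partial sums are controlled up to a zero at \<open>k\<close> and up to a first negative value at
  \<open>l\<close>: cutting off a beginning of such an initial segment subtracts a nonnegative
  partial sum, so every interval that ends at \<open>k\<close> or \<open>l\<close> still has sum at
  most 0. Only the right ends then matter, and the left ends are free to satisfy the mean condition
  and the triangle inequalities.\<close>

section \<open>Invariants of SL2 in three pairs of variables\<close>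

text \<open>\<open>t a b c\<close> is the coefficient of u1^a u2^(A-a) v1^b v2^(B-b) w1^c w2^(C-c)
  in a nonzero polynomial. The last two conditions say that the lowering operator (u2 d/du1 and its
  analogues, summed) and the raising operator (u1 d/du2 and its analogues, summed) annihilate it;
  the support condition is weight zero. Integer indices let the shifts run out of range, where the
  coefficients vanish.\<close>

definition invariant_tensor :: "int \<Rightarrow> int \<Rightarrow> int \<Rightarrow> (int \<Rightarrow> int \<Rightarrow> int \<Rightarrow> real) \<Rightarrow> bool" where
  "invariant_tensor A B C t \<longleftrightarrow>
     (\<exists>a b c. t a b c \<noteq> 0) \<and>
     (\<forall>a b c. t a b c \<noteq> 0 \<longrightarrow> a \<in> {0..A} \<and> b \<in> {0..B} \<and> c \<in> {0..C} \<and> 2 * (a + b + c) = A + B + C) \<and>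
     (\<forall>a b c. of_int (a + 1) * t (a + 1) b c + of_int (b + 1) * t a (b + 1) c
        + of_int (c + 1) * t a b (c + 1) = 0) \<and>
     (\<forall>a b c. of_int (A - a + 1) * t (a - 1) b c + of_int (B - b + 1) * t a (b - 1) c
        + of_int (C - c + 1) * t a b (c - 1) = 0)"

lemma invariant_tensor_rotate:
  assumes "invariant_tensor A B C t"
  shows "invariant_tensor B C A (\<lambda>b c a. t a b c)"
proof -
  have nz: "\<exists>b c a. t a b c \<noteq> 0"
    and supp: "\<And>b c a. t a b c \<noteq> 0 \<Longrightarrow>
      b \<in> {0..B} \<and> c \<in> {0..C} \<and> a \<in> {0..A} \<and> 2 * (b + c + a) = B + C + A"
    using assms unfolding invariant_tensor_def by (blast, force)
  have F: "of_int (a + 1) * t (a + 1) b c + of_int (b + 1) * t a (b + 1) c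
      + of_int (c + 1) * t a b (c + 1) = 0"
    and E: "of_int (A - a + 1) * t (a - 1) b c + of_int (B - b + 1) * t a (b - 1) c
      + of_int (C - c + 1) * t a b (c - 1) = 0" for a b c
    using assms unfolding invariant_tensor_def by blast+
  have "of_int (b + 1) * t a (b + 1) c + of_int (c + 1) * t a b (c + 1)
      + of_int (a + 1) * t (a + 1) b c = 0"
    and "of_int (B - b + 1) * t a (b - 1) c + of_int (C - c + 1) * t a b (c - 1)
      + of_int (A - a + 1) * t (a - 1) b c = 0" for a b c
    using F[of a b c] E[of a b c] by linarith+
  with nz supp show ?thesis
    unfolding invariant_tensor_def by blast
qed

text \<open>Multiplication by the invariant bracket \<open>u1 * v2 - v1 * u2\<close>.\<close>

lemma invariant_tensor_bracket:
  assumes "invariant_tensor A B C t"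
  shows "invariant_tensor (A + 1) (B + 1) C (\<lambda>a b c. t (a - 1) b c - t a (b - 1) c)"
proof -
  have nz: "\<exists>a b c. t a b c \<noteq> 0"
    and supp: "\<And>a b c. t a b c \<noteq> 0 \<Longrightarrow>
      a \<in> {0..A} \<and> b \<in> {0..B} \<and> c \<in> {0..C} \<and> 2 * (a + b + c) = A + B + C"
    and F: "\<And>a b c. of_int (a + 1) * t (a + 1) b c + of_int (b + 1) * t a (b + 1) c
        + of_int (c + 1) * t a b (c + 1) = 0"
    and E: "\<And>a b c. of_int (A - a + 1) * t (a - 1) b c + of_int (B - b + 1) * t a (b - 1) c
        + of_int (C - c + 1) * t a b (c - 1) = 0"
    using assms unfolding invariant_tensor_def by blast+
  have "\<exists>a b c. t (a - 1) b c - t a (b - 1) c \<noteq> 0"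
  proof (rule ccontr)
    assume "\<not> ?thesis"
    then have eq: "t (a - 1) b c = t a (b - 1) c" for a b c by auto
    \<comment> \<open>A vanishing product would make \<open>t\<close> constant along (a + m, b - m).
      Sliding until the second index is negative leaves the support, so \<open>t\<close> would
      vanish.\<close>
    have shift: "t a b c = t (a + int m) (b - int m) c" for a b c m
    proof (induction m)
      case (Suc m)
      show ?case using Suc eq[of "a + int m + 1" "b - int m" c] by (simp add: algebra_simps)
    qed simp
    have "t a b c = 0" for a b c
    proof -
      have "t (a + int (nat (b + 1))) (b - int (nat (b + 1))) c = 0"
        using supp[of "a + int (nat (b + 1))" "b - int (nat (b + 1))" c] by fastforce
      then show ?thesis using shift by metis
    qed
    with nz show False by blast
  qed
  moreover have "a \<in> {0..A+1} \<and> b \<in> {0..B+1} \<and> c \<in> {0..C} \<and> 2 * (a + b + c) = (A+1) + (B+1) + C"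
    if "t (a - 1) b c - t a (b - 1) c \<noteq> 0" for a b c
  proof -
    have "t (a - 1) b c \<noteq> 0 \<or> t a (b - 1) c \<noteq> 0" using that by auto
    then show ?thesis using supp[of "a-1" b c] supp[of a "b-1" c] by auto
  qed
  \<comment> \<open>Both operators are derivations that kill the bracket, so each new identity is
    the old one at (a - 1, b, c) minus the old one at (a, b - 1, c).\<close>
  moreover have "of_int (a + 1) * (t (a + 1 - 1) b c - t (a + 1) (b - 1) c)
      + of_int (b + 1) * (t (a - 1) (b + 1) c - t a (b + 1 - 1) c)
      + of_int (c + 1) * (t (a - 1) b (c + 1) - t a (b - 1) (c + 1)) = 0" for a b c
    using F[of "a - 1" b c] F[of a "b - 1" c] by (simp add: algebra_simps)
  moreover have "of_int (A + 1 - a + 1) * (t (a - 1 - 1) b c - t (a - 1) (b - 1) c)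
      + of_int (B + 1 - b + 1) * (t (a - 1) (b - 1) c - t a (b - 1 - 1) c)
      + of_int (C - c + 1) * (t (a - 1) b (c - 1) - t a (b - 1) (c - 1)) = 0" for a b c
    using E[of "a - 1" b c] E[of a "b - 1" c] by (simp add: algebra_simps)
  ultimately show ?thesis unfolding invariant_tensor_def by blast
qed

text \<open>The invariant is [vw]^x [uw]^y [uv]^z up to sign. Brackets are only multiplied into the
  first two slots, so rotations bring each pair there in turn.\<close>

lemma invariant_tensor_exists:
  "\<exists>t. invariant_tensor (int y + int z) (int x + int z) (int x + int y) t"
proof -
  define Q where "Q A B C \<longleftrightarrow> (\<exists>t. invariant_tensor A B C t)" for A B C
  have rot: "Q A B C \<Longrightarrow> Q B C A" for A B C
    unfolding Q_def using invariant_tensor_rotate by blast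
  have step: "Q A B C \<Longrightarrow> Q (A + int m) (B + int m) C" for A B C m
  proof (induction m)
    case (Suc m)
    then show ?case
      unfolding Q_def using invariant_tensor_bracket by (fastforce simp: ac_simps)
  qed simp
  have "invariant_tensor 0 0 0 (\<lambda>a b c. if a = 0 \<and> b = 0 \<and> c = 0 then 1 else 0)"
    unfolding invariant_tensor_def by auto
  then have "Q 0 0 0" unfolding Q_def by blast
  then have "Q (int z) (int z) 0" using step[of 0 0 0 z] by simp
  from step[OF rot[OF this], of x] have "Q (int z + int x) (int x) (int z)" by simp
  from rot[OF step[OF rot[OF this], of y]] show ?thesis
    unfolding Q_def by (simp add: add.commute)
qed

section \<open>Uniform marginals of the squared coefficients\<close>

text \<open>Reindexing by one, since the weight h b = b! (B - b)! satisfies (b + 1) h b = (B - b) h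
  (b + 1). The boundary terms vanish because \<open>g (B + 1)\<close> and \<open>q (-1)\<close>
  do.\<close>

lemma sum_shift_adjoint:
  fixes g q :: "int \<Rightarrow> real"
  assumes "\<And>b. b \<notin> {0..B} \<Longrightarrow> g b = 0" "\<And>b. b \<notin> {0..B} \<Longrightarrow> q b = 0"
  shows "(\<Sum>b\<in>{0..B}. of_int (b + 1) * g (b + 1) * q b * (fact (nat b) * fact (nat (B - b))))
       = (\<Sum>b\<in>{0..B}. of_int (B - b + 1) * g b * q (b - 1) * (fact (nat b) * fact (nat (B - b))))"
proof -
  let ?h = "\<lambda>b. fact (nat b) * fact (nat (B - b)) :: real"
  have h: "of_int (b + 1) * ?h b = of_int (B - b) * ?h (b + 1)" if "b \<in> {0..B-1}" for b
  proof -
    have "nat (b + 1) = Suc (nat b)" "nat (B - b) = Suc (nat (B - (b + 1)))" using that by auto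
    then show ?thesis using that by (simp add: algebra_simps)
  qed
  have "(\<Sum>b\<in>{0..B}. of_int (b + 1) * g (b + 1) * q b * ?h b)
      = (\<Sum>b\<in>{0..B-1}. of_int (b + 1) * g (b + 1) * q b * ?h b)"
    by (rule sum.mono_neutral_right) (use assms(1) in auto)
  also have "\<dots> = (\<Sum>b\<in>{1..B}. of_int (B - b + 1) * g b * q (b - 1) * ?h b)"
  proof (rule sum.reindex_bij_witness[of _ "\<lambda>b. b - 1" "\<lambda>b. b + 1"])
    fix b assume b: "b \<in> {0..B-1}"
    show "of_int (B - (b + 1) + 1) * g (b + 1) * q (b + 1 - 1) * ?h (b + 1)
        = of_int (b + 1) * g (b + 1) * q b * ?h b"
      using h[OF b] by (simp add: mult_ac)
  qed auto
  also have "\<dots> = (\<Sum>b\<in>{0..B}. of_int (B - b + 1) * g b * q (b - 1) * ?h b)"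
  proof (rule sum.mono_neutral_left)
    show "\<forall>b\<in>{0..B} - {1..B}. of_int (B - b + 1) * g b * q (b - 1) * ?h b = 0"
    proof
      fix b assume "b \<in> {0..B} - {1..B}"
      then have "b = 0" by auto
      then show "of_int (B - b + 1) * g b * q (b - 1) * ?h b = 0" using assms(2)[of "-1"] by simp
    qed
  qed auto
  finally show ?thesis .
qed

text \<open>The factorials are the invariant inner product, for which raising and lowering are adjoint.\<close>

definition tensor_weight :: "int \<Rightarrow> int \<Rightarrow> int \<Rightarrow> (int \<Rightarrow> int \<Rightarrow> int \<Rightarrow> real) \<Rightarrow> int \<Rightarrow> int \<Rightarrow> int \<Rightarrow> real" where
  "tensor_weight A B C t a b c = (t a b c)\<^sup>2 * (fact (nat a) * fact (nat (A - a)))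
     * (fact (nat b) * fact (nat (B - b))) * (fact (nat c) * fact (nat (C - c)))"

text \<open>Pair the lowering identity at (a, b, c) with \<open>t (a + 1) b c\<close>, move lowering
  in \<open>b\<close> and \<open>c\<close> over to raising by adjointness, and apply the raising
  identity at (a + 1, b, c). This gives (a + 1) S (a + 1) = (A - a) S a, which the factors a! (A -
  a)! turn into equality.\<close>

lemma tensor_weight_marginal_step:
  assumes t: "invariant_tensor A B C t" and a: "0 \<le> a" "a < A"
  shows "(\<Sum>b\<in>{0..B}. \<Sum>c\<in>{0..C}. tensor_weight A B C t (a + 1) b c)
       = (\<Sum>b\<in>{0..B}. \<Sum>c\<in>{0..C}. tensor_weight A B C t a b c)"
proof -
  have supp: "\<And>a b c. \<not> (a \<in> {0..A} \<and> b \<in> {0..B} \<and> c \<in> {0..C}) \<Longrightarrow> t a b c = 0"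
    and F: "\<And>a b c. of_int (a + 1) * t (a + 1) b c + of_int (b + 1) * t a (b + 1) c
        + of_int (c + 1) * t a b (c + 1) = 0"
    and E: "\<And>a b c. of_int (A - a + 1) * t (a - 1) b c + of_int (B - b + 1) * t a (b - 1) c
        + of_int (C - c + 1) * t a b (c - 1) = 0"
    using t unfolding invariant_tensor_def by blast+
  define hB where "hB b = (fact (nat b) * fact (nat (B - b)) :: real)" for b
  define hC where "hC c = (fact (nat c) * fact (nat (C - c)) :: real)" for c
  define S where "S a = (\<Sum>b\<in>{0..B}. \<Sum>c\<in>{0..C}. (t a b c)\<^sup>2 * hB b * hC c)" for a
  have wS: "(\<Sum>b\<in>{0..B}. \<Sum>c\<in>{0..C}. tensor_weight A B C t a b c)
      = fact (nat a) * fact (nat (A - a)) * S a" for a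
    by (simp add: tensor_weight_def S_def hB_def hC_def sum_distrib_left mult_ac)
  have shB: "(\<Sum>b\<in>{0..B}. \<Sum>c\<in>{0..C}. of_int (b + 1) * t a (b + 1) c * t (a + 1) b c * hB b * hC c)
      = (\<Sum>b\<in>{0..B}. \<Sum>c\<in>{0..C}. of_int (B - b + 1) * t a b c * t (a + 1) (b - 1) c * hB b * hC c)"
    (is "?L1 = ?R1")
  proof -
    have "?L1 = (\<Sum>c\<in>{0..C}. (\<Sum>b\<in>{0..B}. of_int (b + 1) * t a (b + 1) c * t (a + 1) b c * hB b) * hC c)"
      by (subst sum.swap) (simp add: sum_distrib_right)
    also have "\<dots> = (\<Sum>c\<in>{0..C}. (\<Sum>b\<in>{0..B}. of_int (B - b + 1) * t a b c * t (a + 1) (b - 1) c * hB b) * hC c)"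
      unfolding hB_def
      by (intro sum.cong refl arg_cong2[where f = "(*)"]
            sum_shift_adjoint[where g = "\<lambda>b. t a b c" and q = "\<lambda>b. t (a + 1) b c" for c] supp) auto
    also have "\<dots> = ?R1"
      by (subst sum.swap) (simp add: sum_distrib_right)
    finally show ?thesis .
  qed
  have shC: "(\<Sum>b\<in>{0..B}. \<Sum>c\<in>{0..C}. of_int (c + 1) * t a b (c + 1) * t (a + 1) b c * hB b * hC c)
      = (\<Sum>b\<in>{0..B}. \<Sum>c\<in>{0..C}. of_int (C - c + 1) * t a b c * t (a + 1) b (c - 1) * hB b * hC c)"
    (is "?L2 = ?R2")
  proof -
    have "?L2 = (\<Sum>b\<in>{0..B}. (\<Sum>c\<in>{0..C}. of_int (c + 1) * t a b (c + 1) * t (a + 1) b c * hC c) * hB b)"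
      by (simp add: sum_distrib_left sum_distrib_right mult_ac)
    also have "\<dots> = (\<Sum>b\<in>{0..B}. (\<Sum>c\<in>{0..C}. of_int (C - c + 1) * t a b c * t (a + 1) b (c - 1) * hC c) * hB b)"
      unfolding hC_def
      by (intro sum.cong refl arg_cong2[where f = "(*)"]
            sum_shift_adjoint[where g = "\<lambda>c. t a b c" and q = "\<lambda>c. t (a + 1) b c" for b] supp) auto
    also have "\<dots> = ?R2"
      by (simp add: sum_distrib_left sum_distrib_right mult_ac)
    finally show ?thesis .
  qed
  have e1: "of_int (a + 1) * t (a + 1) b c = - (of_int (b + 1) * t a (b + 1) c + of_int (c + 1) * t a b (c + 1))"
    for b c using F[of a b c] by linarith
  have e2: "- (of_int (B - b + 1) * t (a + 1) (b - 1) c + of_int (C - c + 1) * t (a + 1) b (c - 1))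
      = of_int (A - a) * t a b c" for b c
    using E[of "a + 1" b c] by (simp add: algebra_simps)
  have "of_int (a + 1) * S (a + 1)
      = (\<Sum>b\<in>{0..B}. \<Sum>c\<in>{0..C}. (of_int (a + 1) * t (a + 1) b c) * t (a + 1) b c * hB b * hC c)"
    by (simp add: S_def sum_distrib_left power2_eq_square mult_ac)
  also have "\<dots> = - (?L1 + ?L2)"
    unfolding e1 sum.distrib[symmetric] sum_negf[symmetric]
    by (intro sum.cong refl) (simp add: algebra_simps)
  also have "\<dots> = - (?R1 + ?R2)"
    by (simp only: shB shC)
  also have "\<dots> = (\<Sum>b\<in>{0..B}. \<Sum>c\<in>{0..C}.
      (- (of_int (B - b + 1) * t (a + 1) (b - 1) c + of_int (C - c + 1) * t (a + 1) b (c - 1))) * t a b c * hB b * hC c)"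
    unfolding sum.distrib[symmetric] sum_negf[symmetric]
    by (intro sum.cong refl) (simp add: algebra_simps)
  also have "\<dots> = of_int (A - a) * S a"
    unfolding e2 by (simp add: S_def sum_distrib_left power2_eq_square mult_ac)
  finally have rec: "of_int (a + 1) * S (a + 1) = of_int (A - a) * S a" .
  have f1: "fact (nat (a + 1)) = of_int (a + 1) * (fact (nat a) :: real)"
    using a by (simp add: nat_add_distrib)
  have f2: "fact (nat (A - a)) = of_int (A - a) * (fact (nat (A - (a + 1))) :: real)"
  proof -
    have "nat (A - a) = Suc (nat (A - (a + 1)))" using a by auto
    then show ?thesis using a by simp
  qed
  have "fact (nat (a + 1)) * fact (nat (A - (a + 1))) * S (a + 1)
      = fact (nat a) * fact (nat (A - (a + 1))) * (of_int (a + 1) * S (a + 1))"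
    unfolding f1 by (simp only: mult_ac)
  also have "\<dots> = fact (nat a) * fact (nat (A - a)) * S a"
    unfolding rec f2 by (simp only: mult_ac)
  finally show ?thesis unfolding wS .
qed

lemma tensor_weight_marginal:
  assumes t: "invariant_tensor A B C t" and a: "a \<in> {0..A}"
  shows "of_int (A + 1) * (\<Sum>b\<in>{0..B}. \<Sum>c\<in>{0..C}. tensor_weight A B C t a b c)
       = (\<Sum>a\<in>{0..A}. \<Sum>b\<in>{0..B}. \<Sum>c\<in>{0..C}. tensor_weight A B C t a b c)"
proof -
  define m where "m a = (\<Sum>b\<in>{0..B}. \<Sum>c\<in>{0..C}. tensor_weight A B C t a b c)" for a
  have nat: "int k \<le> A \<Longrightarrow> m (int k) = m 0" for k
  proof (induction k)
    case (Suc k)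
    then show ?case using tensor_weight_marginal_step[OF t, of "int k"] unfolding m_def
      by (simp add: add.commute)
  qed simp
  have const: "m a = m 0" if "a \<in> {0..A}" for a
    using nat[of "nat a"] that by simp
  have "(\<Sum>a\<in>{0..A}. m a) = (\<Sum>a\<in>{0..A}. m 0)"
    by (intro sum.cong refl const)
  then show ?thesis using const[OF a] a unfolding m_def[symmetric] by simp
qed

lemma sum_rotate:
  "(\<Sum>a\<in>A. \<Sum>b\<in>B. \<Sum>c\<in>C. f a b c) = (\<Sum>b\<in>B. \<Sum>c\<in>C. \<Sum>a\<in>A. f a b c)"
  by (rule trans[OF sum.swap sum.cong[OF refl sum.swap]])

section \<open>Averages over three intervals\<close>

text \<open>Integrate the hypothesis against \<open>tensor_weight\<close>: where the weight is
  nonzero, a + b + c = x + y + z, and each marginal is constant. Three different functions are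
  allowed because the intervals will be translated by different offsets.\<close>

lemma uniform_coupling_averages:
  fixes f g h :: "nat \<Rightarrow> real"
  assumes pos: "\<And>a b c. a \<le> y + z \<Longrightarrow> b \<le> x + z \<Longrightarrow> c \<le> x + y \<Longrightarrow> a + b + c = x + y + z \<Longrightarrow>
      f a + g b + h c \<ge> 0"
  shows "(\<Sum>a\<le>y+z. f a) / real (y + z + 1) + (\<Sum>b\<le>x+z. g b) / real (x + z + 1)
     + (\<Sum>c\<le>x+y. h c) / real (x + y + 1) \<ge> 0"
proof -
  define A B C where "A = int (y + z)" and "B = int (x + z)" and "C = int (x + y)"
  obtain t where t: "invariant_tensor A B C t"
    using invariant_tensor_exists unfolding A_def B_def C_def of_nat_add by blast
  have t2: "invariant_tensor B C A (\<lambda>b c a. t a b c)"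
    using invariant_tensor_rotate[OF t] .
  have t3: "invariant_tensor C A B (\<lambda>c a b. t a b c)"
    using invariant_tensor_rotate[OF t2] .
  define w where "w = tensor_weight A B C t"
  define W where "W = (\<Sum>a\<in>{0..A}. \<Sum>b\<in>{0..B}. \<Sum>c\<in>{0..C}. w a b c)"
  have w2: "tensor_weight B C A (\<lambda>b c a. t a b c) = (\<lambda>b c a. w a b c)"
    and w3: "tensor_weight C A B (\<lambda>c a b. t a b c) = (\<lambda>c a b. w a b c)"
    by (simp_all add: w_def tensor_weight_def fun_eq_iff mult_ac)
  have m1: "of_int (A + 1) * (\<Sum>b\<in>{0..B}. \<Sum>c\<in>{0..C}. w a b c) = W" if "a \<in> {0..A}" for a
    using tensor_weight_marginal[OF t that] unfolding W_def w_def .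
  have m2: "of_int (B + 1) * (\<Sum>c\<in>{0..C}. \<Sum>a\<in>{0..A}. w a b c) = W" if "b \<in> {0..B}" for b
    using tensor_weight_marginal[OF t2 that] unfolding w2 W_def by (simp only: sum_rotate[of "\<lambda>a b c. w a b c" "{0..C}" "{0..B}" "{0..A}"])
  have m3: "of_int (C + 1) * (\<Sum>a\<in>{0..A}. \<Sum>b\<in>{0..B}. w a b c) = W" if "c \<in> {0..C}" for c
    using tensor_weight_marginal[OF t3 that] unfolding w3 W_def by (simp only: sum_rotate[of "\<lambda>c a b. w a b c" "{0..B}" "{0..A}" "{0..C}"])
  have w_nonneg: "w a b c \<ge> 0" for a b c
    by (simp add: w_def tensor_weight_def)
  have W_pos: "W > 0"
  proof -
    obtain a b c where nz: "t a b c \<noteq> 0" and abc: "a \<in> {0..A}" "b \<in> {0..B}" "c \<in> {0..C}"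
      using t unfolding invariant_tensor_def by blast
    have "0 < w a b c" using nz by (simp add: w_def tensor_weight_def)
    also have "\<dots> \<le> (\<Sum>c\<in>{0..C}. w a b c)"
      using abc by (intro member_le_sum w_nonneg) auto
    also have "\<dots> \<le> (\<Sum>b\<in>{0..B}. \<Sum>c\<in>{0..C}. w a b c)"
      using abc by (intro member_le_sum sum_nonneg w_nonneg) auto
    also have "\<dots> \<le> W"
      unfolding W_def using abc by (intro member_le_sum sum_nonneg w_nonneg) auto
    finally show ?thesis .
  qed
  have avg: "(\<Sum>i\<in>{0..int k}. f (nat i) * M i) = W * ((\<Sum>i\<le>k. f i) / real (k + 1))"
    if "\<And>i. i \<in> {0..int k} \<Longrightarrow> of_int (int k + 1) * M i = W" for k M and f :: "nat \<Rightarrow> real"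
  proof -
    have "(\<Sum>i\<in>{0..int k}. f (nat i) * M i) = (\<Sum>i\<in>{0..int k}. f (nat i) * (W / real (k + 1)))"
    proof (intro sum.cong refl arg_cong2[where f = "(*)"])
      fix i assume "i \<in> {0..int k}"
      from that[OF this] show "M i = W / real (k + 1)" by (simp add: field_simps)
    qed
    also have "\<dots> = (\<Sum>i\<le>k. f i * (W / real (k + 1)))"
      by (rule sum.reindex_bij_witness[of _ int nat]) auto
    finally show ?thesis by (simp add: sum_distrib_left sum_divide_distrib mult_ac)
  qed
  have "0 \<le> (\<Sum>a\<in>{0..A}. \<Sum>b\<in>{0..B}. \<Sum>c\<in>{0..C}. w a b c * (f (nat a) + g (nat b) + h (nat c)))"
  proof (intro sum_nonneg)
    fix a b c assume abc: "a \<in> {0..A}" "b \<in> {0..B}" "c \<in> {0..C}"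
    show "0 \<le> w a b c * (f (nat a) + g (nat b) + h (nat c))"
    proof (cases "t a b c = 0")
      case True
      then show ?thesis by (simp add: w_def tensor_weight_def)
    next
      case False
      then have "2 * (a + b + c) = A + B + C" using t unfolding invariant_tensor_def by blast
      then have "f (nat a) + g (nat b) + h (nat c) \<ge> 0"
        using abc by (intro pos) (auto simp: A_def B_def C_def)
      then show ?thesis using w_nonneg by simp
    qed
  qed
  also have "\<dots> = (\<Sum>a\<in>{0..A}. f (nat a) * (\<Sum>b\<in>{0..B}. \<Sum>c\<in>{0..C}. w a b c))
     + (\<Sum>b\<in>{0..B}. g (nat b) * (\<Sum>c\<in>{0..C}. \<Sum>a\<in>{0..A}. w a b c))
     + (\<Sum>c\<in>{0..C}. h (nat c) * (\<Sum>a\<in>{0..A}. \<Sum>b\<in>{0..B}. w a b c))"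
  proof -
    have 2: "(\<Sum>b\<in>{0..B}. g (nat b) * (\<Sum>c\<in>{0..C}. \<Sum>a\<in>{0..A}. w a b c))
        = (\<Sum>a\<in>{0..A}. \<Sum>b\<in>{0..B}. \<Sum>c\<in>{0..C}. g (nat b) * w a b c)"
      unfolding sum_distrib_left by (rule sum_rotate[symmetric])
    have 3: "(\<Sum>c\<in>{0..C}. h (nat c) * (\<Sum>a\<in>{0..A}. \<Sum>b\<in>{0..B}. w a b c))
        = (\<Sum>a\<in>{0..A}. \<Sum>b\<in>{0..B}. \<Sum>c\<in>{0..C}. h (nat c) * w a b c)"
      unfolding sum_distrib_left by (rule sum_rotate)
    show ?thesis
      unfolding 2 3 unfolding sum_distrib_left sum.distrib[symmetric] by (simp add: algebra_simps)
  qed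
  also have "(\<Sum>a\<in>{0..A}. f (nat a) * (\<Sum>b\<in>{0..B}. \<Sum>c\<in>{0..C}. w a b c))
      = W * ((\<Sum>a\<le>y+z. f a) / real (y + z + 1))"
    using avg[of "y + z", OF m1[unfolded A_def]] unfolding A_def by simp
  also have "(\<Sum>b\<in>{0..B}. g (nat b) * (\<Sum>c\<in>{0..C}. \<Sum>a\<in>{0..A}. w a b c))
      = W * ((\<Sum>b\<le>x+z. g b) / real (x + z + 1))"
    using avg[of "x + z", OF m2[unfolded B_def]] unfolding B_def by simp
  also have "(\<Sum>c\<in>{0..C}. h (nat c) * (\<Sum>a\<in>{0..A}. \<Sum>b\<in>{0..B}. w a b c))
      = W * ((\<Sum>c\<le>x+y. h c) / real (x + y + 1))"
    using avg[of "x + y", OF m3[unfolded C_def]] unfolding C_def by simp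
  finally have "0 \<le> W * ((\<Sum>a\<le>y+z. f a) / real (y + z + 1) + (\<Sum>b\<le>x+z. g b) / real (x + z + 1)
     + (\<Sum>c\<le>x+y. h c) / real (x + y + 1))"
    by (simp only: distrib_left)
  then show ?thesis using W_pos by (simp add: zero_le_mult_iff)
qed

lemma interval_averages_nonneg:
  fixes g :: "nat \<Rightarrow> real"
  assumes g: "\<And>a b c. a + b + c = n \<Longrightarrow> g a + g b + g c \<ge> 0"
    and mean: "i1 + i2 + i3 + t1 + t2 + t3 = 2 * n"
    and tri: "t1 + i2 + i3 \<le> n" "t2 + i1 + i3 \<le> n" "t3 + i1 + i2 \<le> n"
  shows "(\<Sum>j=i1..t1. g j) / real (t1 - i1 + 1) + (\<Sum>j=i2..t2. g j) / real (t2 - i2 + 1)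
     + (\<Sum>j=i3..t3. g j) / real (t3 - i3 + 1) \<ge> 0"
proof -
  \<comment> \<open>Under \<open>mean\<close>, \<open>x\<close> is half the excess of the second and
    third lengths over the first, and likewise \<open>y\<close> and \<open>z\<close>; so
    \<open>tri\<close> is the triangle inequality for the lengths.\<close>
  define x y z where "x = n - (t1 + i2 + i3)" and "y = n - (t2 + i1 + i3)" and "z = n - (t3 + i1 + i2)"
  have t: "t1 = i1 + (y + z)" "t2 = i2 + (x + z)" "t3 = i3 + (x + y)" "i1 + i2 + i3 + x + y + z = n"
    using mean tri unfolding x_def y_def z_def by linarith+
  have sh: "(\<Sum>j=i..i+k. g j) = (\<Sum>j\<le>k. g (i + j))" for i k
    by (rule sum.reindex_bij_witness[of _ "\<lambda>j. i + j" "\<lambda>j. j - i"]) auto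
  have "0 \<le> (\<Sum>a\<le>y+z. g (i1 + a)) / real (y + z + 1) + (\<Sum>b\<le>x+z. g (i2 + b)) / real (x + z + 1)
     + (\<Sum>c\<le>x+y. g (i3 + c)) / real (x + y + 1)"
    by (rule uniform_coupling_averages) (use t(4) in \<open>auto intro!: g\<close>)
  then show ?thesis unfolding t(1-3) sh by simp
qed

text \<open>Once the sum of the bottoms is fixed, each triangle inequality is a lower bound on one
  bottom, such as i1 \<ge> n - t2 - t3. So \<open>i2\<close> and \<open>i3\<close> take their least
  values (truncated at 0) and \<open>i1\<close> absorbs the rest.\<close>

lemma interval_bottoms_exist:
  fixes n t1 t2 t3 :: nat
  assumes "t1 \<le> n" "t2 \<le> n" "t3 \<le> n" "n \<le> t1 + t2 + t3" "t1 + t2 + t3 \<le> 2 * n"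
  obtains i1 i2 i3 where "i1 + i2 + i3 + t1 + t2 + t3 = 2 * n"
    "t1 + i2 + i3 \<le> n" "t2 + i1 + i3 \<le> n" "t3 + i1 + i2 \<le> n"
proof
  let ?i2 = "n - (t1 + t3)" and ?i3 = "n - (t1 + t2)"
  let ?i1 = "2 * n - (t1 + t2 + t3) - ?i2 - ?i3"
  show "?i1 + ?i2 + ?i3 + t1 + t2 + t3 = 2 * n" "t1 + ?i2 + ?i3 \<le> n"
    "t2 + ?i1 + ?i3 \<le> n" "t3 + ?i1 + ?i2 \<le> n"
    using assms by linarith+
qed

section \<open>The tilt, and pairing with decreasing weights\<close>

lemma sum_centered: "2 * (\<Sum>j\<le>k. 3 * real j - real n) = (real k + 1) * (3 * real k - 2 * real n)"
  by (induction k) (auto simp: algebra_simps)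

text \<open>The centered sums \<open>H k\<close> are negative exactly for 3k < 2n, so there
  \<open>\<beta>\<close> is bounded above. Taking the extreme value creates a zero partial sum, and
  a later negative one would contradict the interval averages. The tilt leaves the hypothesis on
  triples intact, since 3(a + b + c) - 3n = 0.\<close>

lemma exists_tilt_partial_sums_nonneg:
  fixes f :: "nat \<Rightarrow> real"
  assumes f: "\<And>a b c. a + b + c = n \<Longrightarrow> f a + f b + f c \<ge> 0" and n: "n > 0"
  shows "\<exists>\<beta>. \<forall>k\<le>n. (\<Sum>j\<le>k. f j + \<beta> * (3 * real j - real n)) \<ge> 0"
proof -
  define H where "H k = (\<Sum>j\<le>k. 3 * real j - real n)" for k
  have H_neg: "H k < 0" if "3 * k < 2 * n" for k
  proof -
    have "(real k + 1) * (3 * real k - 2 * real n) < 0"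
      using that by (intro mult_pos_neg) auto
    then show ?thesis using sum_centered[of n k] unfolding H_def by linarith
  qed
  define K where "K = {k. 3 * k < 2 * n}"
  have "K \<subseteq> {..2*n}" by (auto simp: K_def)
  then have fin: "finite K" by (rule finite_subset) simp
  have "0 \<in> K" using n by (simp add: K_def)
  then have ne: "K \<noteq> {}" by blast
  \<comment> \<open>The largest tilt keeping the partial sums up to every \<open>k < 2 * n / 3\<close> nonnegative.\<close>
  define \<beta> where "\<beta> = Min ((\<lambda>k. (\<Sum>j\<le>k. f j) / - H k) ` K)"
  define g where "g j = f j + \<beta> * (3 * real j - real n)" for j
  define G where "G k = (\<Sum>j\<le>k. g j)" for k
  have G_eq: "G k = (\<Sum>j\<le>k. f j) + \<beta> * H k" for k
    unfolding G_def g_def H_def by (simp add: sum.distrib sum_distrib_left)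
  have g: "g a + g b + g c \<ge> 0" if "a + b + c = n" for a b c
  proof -
    have "g a + g b + g c = f a + f b + f c + \<beta> * (3 * (real (a + b + c) - real n))"
      unfolding g_def by (simp add: algebra_simps)
    then show ?thesis using f[OF that] that by simp
  qed
  have GK: "G k \<ge> 0" if "3 * k < 2 * n" for k
  proof -
    have "\<beta> \<le> (\<Sum>j\<le>k. f j) / - H k"
      unfolding \<beta>_def using fin that by (intro Min_le) (auto simp: K_def)
    then show ?thesis using H_neg[OF that] unfolding G_eq
      by (simp add: field_simps)
  qed
  have "\<beta> \<in> (\<lambda>k. (\<Sum>j\<le>k. f j) / - H k) ` K"
    unfolding \<beta>_def using fin ne by (intro Min_in) auto
  then obtain k0 where k0: "3 * k0 < 2 * n" "\<beta> = (\<Sum>j\<le>k0. f j) / - H k0"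
    by (auto simp: K_def)
  then have "G k0 = 0" using H_neg[OF k0(1)] unfolding G_eq by (simp add: field_simps)
  \<comment> \<open>The least zero is taken so that earlier partial sums are nonzero; the last case
    below needs that strictness.\<close>
  define k where "k = (LEAST k. G k = 0)"
  have Gk: "G k = 0" unfolding k_def using \<open>G k0 = 0\<close> by (rule LeastI)
  have k_min: "G j \<noteq> 0" if "j < k" for j using that not_less_Least unfolding k_def by blast
  have "k \<le> k0" unfolding k_def using \<open>G k0 = 0\<close> by (rule Least_le)
  then have k: "3 * k < 2 * n" using k0 by linarith
  have "\<forall>l\<le>n. G l \<ge> 0"
  proof (rule ccontr)
    assume "\<not> ?thesis"
    then obtain l0 where l0: "l0 \<le> n" "G l0 < 0" by force
    define l where "l = (LEAST l. G l < 0)"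
    have Gl: "G l < 0" unfolding l_def using l0(2) by (rule LeastI)
    have "l \<le> l0" unfolding l_def using l0(2) by (rule Least_le)
    then have ln: "l \<le> n" using l0 by linarith
    have G_nonneg: "G j \<ge> 0" if "j < l" for j
      using that not_less_Least unfolding l_def by fastforce
    have l: "2 * n \<le> 3 * l" using GK[of l] Gl by linarith
    have tail: "(\<Sum>j=i..t. g j) = G t - (if i = 0 then 0 else G (i - 1))" if "i \<le> t" for i t
    proof (cases i)
      case 0
      then show ?thesis by (simp add: G_def atMost_atLeast0)
    next
      case (Suc m)
      have "{..t} = {..m} \<union> {Suc m..t}" "{..m} \<inter> {Suc m..t} = {}" using that Suc by auto
      then have "G t = G m + (\<Sum>j=Suc m..t. g j)" unfolding G_def
        by (metis finite_atLeastAtMost finite_atMost sum.union_disjoint)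
      then show ?thesis using Suc by simp
    qed
    \<comment> \<open>The sum over {i..k} is minus an earlier partial sum, or empty. Only its sign
      matters, so the denominator is left arbitrary.\<close>
    have tail_k: "(\<Sum>j=i..k. g j) / real m \<le> 0" for i m
    proof -
      have "(\<Sum>j=i..k. g j) \<le> 0"
      proof (cases "i \<le> k")
        case True
        then show ?thesis using tail[OF True] Gk G_nonneg[of "i - 1"] k l by auto
      qed simp
      then show ?thesis by (simp add: divide_nonpos_nonneg)
    qed
    have tail_l: "(\<Sum>j=i..l. g j) / real (l - i + 1) < 0" if "i \<le> l" for i
    proof -
      have "0 \<le> (if i = 0 then 0 else G (i - 1))" using G_nonneg that by auto
      then have "(\<Sum>j=i..l. g j) < 0" using tail[OF that] Gl by linarith
      then show ?thesis by (simp add: divide_neg_pos)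
    qed
    \<comment> \<open>Choose right ends among \<open>k\<close> and \<open>l\<close> whose total lies
      between n and 2n: (l, l, k) if 2k + l is too small, (l, k, k) if it fits. If it is too large,
      then 2k > n and intervals ending at \<open>k\<close> alone suffice.\<close>
    consider "2 * k + l < n" | "n \<le> 2 * k + l" "2 * k + l \<le> 2 * n" | "2 * n < 2 * k + l" by linarith
    then show False
    proof cases
      case 1
      obtain i1 i2 i3 where i: "i1 + i2 + i3 + l + l + k = 2 * n"
        "l + i2 + i3 \<le> n" "l + i1 + i3 \<le> n" "k + i1 + i2 \<le> n"
        by (rule interval_bottoms_exist[of l n l k]) (use 1 ln k l in linarith)+
      have "i1 \<le> l" "i2 \<le> l" using i by linarith+
      then show False
        using interval_averages_nonneg[where g = g, OF g i] tail_l[of i1] tail_l[of i2] tail_k[of i3 "k - i3 + 1"]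
        by linarith
    next
      case 2
      obtain i1 i2 i3 where i: "i1 + i2 + i3 + l + k + k = 2 * n"
        "l + i2 + i3 \<le> n" "k + i1 + i3 \<le> n" "k + i1 + i2 \<le> n"
        by (rule interval_bottoms_exist[of l n k k]) (use 2 ln k l in linarith)+
      have "i1 \<le> l" using i by linarith
      then show False
        using interval_averages_nonneg[where g = g, OF g i] tail_l[of i1] tail_k[of i2 "k - i2 + 1"]
          tail_k[of i3 "k - i3 + 1"]
        by linarith
    next
      case 3
      \<comment> \<open>The mean condition for {i..k}, {0..k}, {0..k} forces this value. The last
        two sums are G k = 0 and the first is - G (i - 1), which is strictly negative as i - 1 <
        k.\<close>
      define i where "i = 2 * n - 3 * k"
      have i: "0 < i" "i \<le> k" "i - 1 < k" using 3 k ln unfolding i_def by linarith+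
      have "0 \<le> (\<Sum>j=i..k. g j) / real (k - i + 1) + (\<Sum>j=0..k. g j) / real (k - 0 + 1)
          + (\<Sum>j=0..k. g j) / real (k - 0 + 1)"
        by (rule interval_averages_nonneg[OF g]) (use 3 k ln in \<open>auto simp: i_def\<close>)
      then have "0 \<le> - G (i - 1) / real (k - i + 1)"
        using tail[OF i(2)] tail[of 0 k] i Gk by simp
      then have "0 \<le> - G (i - 1)"
        by (simp only: zero_le_divide_iff) auto
      moreover have "G (i - 1) \<ge> 0" using G_nonneg i k l by auto
      ultimately show False using k_min[OF i(3)] by linarith
    qed
  qed
  then show ?thesis unfolding G_def g_def by blast
qed

text \<open>Abel summation, run as an induction that keeps the weighted sum up to \<open>m\<close>
  above \<open>q m\<close> times the plain partial sum.\<close>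

lemma sum_by_parts_decreasing:
  fixes q g :: "nat \<Rightarrow> real"
  assumes "\<And>k. k < n \<Longrightarrow> q (Suc k) \<le> q k" "q n \<ge> 0" "\<And>k. k \<le> n \<Longrightarrow> (\<Sum>j\<le>k. g j) \<ge> 0"
  shows "(\<Sum>j\<le>n. q j * g j) \<ge> 0"
proof -
  have "(\<Sum>j\<le>m. q j * g j) \<ge> q m * (\<Sum>j\<le>m. g j)" if "m \<le> n" for m
    using that
  proof (induction m)
    case (Suc m)
    have "q (Suc m) * (\<Sum>j\<le>m. g j) \<le> q m * (\<Sum>j\<le>m. g j)"
      using Suc.prems assms by (intro mult_right_mono) auto
    then show ?case using Suc by (simp add: distrib_left)
  qed simp
  from this[of n] show ?thesis using assms(2) assms(3)[of n] by (meson mult_nonneg_nonneg order_refl order_trans)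
qed

lemma decreasing_pairing_nonneg:
  fixes q f :: "nat \<Rightarrow> real"
  assumes "\<And>k. k < n \<Longrightarrow> q (Suc k) \<le> q k" "q n \<ge> 0" and n: "n > 0"
    and mean: "(\<Sum>j\<le>n. q j * (3 * real j - real n)) = 0"
    and f: "\<And>a b c. a + b + c = n \<Longrightarrow> f a + f b + f c \<ge> 0"
  shows "(\<Sum>j\<le>n. q j * f j) \<ge> 0"
proof -
  obtain \<beta> where "\<And>k. k \<le> n \<Longrightarrow> (\<Sum>j\<le>k. f j + \<beta> * (3 * real j - real n)) \<ge> 0"
    using exists_tilt_partial_sums_nonneg[of n f] f n by blast
  then have "0 \<le> (\<Sum>j\<le>n. q j * (f j + \<beta> * (3 * real j - real n)))"
    using assms by (intro sum_by_parts_decreasing) auto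
  also have "\<dots> = (\<Sum>j\<le>n. q j * f j) + \<beta> * (\<Sum>j\<le>n. q j * (3 * real j - real n))"
    by (simp add: distrib_left sum.distrib sum_distrib_left mult_ac)
  finally show ?thesis using mean by simp
qed

section \<open>Separation from a finite convex hull\<close>

lemma convex_combination_if_not_separated:
  fixes e :: "'t \<Rightarrow> 'j \<Rightarrow> real" and v :: "'j \<Rightarrow> real"
  assumes fin: "finite T" "T \<noteq> {}" "finite J"
    and sep: "\<And>f c. (\<And>t. t \<in> T \<Longrightarrow> c \<le> (\<Sum>j\<in>J. e t j * f j)) \<Longrightarrow> c \<le> (\<Sum>j\<in>J. v j * f j)"
  obtains w where "\<And>t. t \<in> T \<Longrightarrow> w t \<ge> 0" "(\<Sum>t\<in>T. w t) = 1"
    "\<And>j. j \<in> J \<Longrightarrow> (\<Sum>t\<in>T. w t * e t j) = v j"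
proof -
  \<comment> \<open>Weights are functions on the whole type, pinned to 0 off \<open>T\<close>, so
    that the box is a product of compact sets.\<close>
  define box where "box = PiE UNIV (\<lambda>t. if t \<in> T then {0..1::real} else {0})"
  define S where "S = box \<inter> {w. (\<Sum>t\<in>T. w t) = 1}"
  have "compactin (product_topology (\<lambda>_. euclidean) UNIV) box"
    unfolding box_def compactin_PiE by simp
  then have "compact box"
    by (simp add: euclidean_product_topology)
  moreover have "closed {w :: 't \<Rightarrow> real. (\<Sum>t\<in>T. w t) = 1}"
    by (intro closed_Collect_eq continuous_intros continuous_on_product_coordinates)
  ultimately have "compact S" unfolding S_def by (rule compact_Int_closed)
  moreover have "S \<noteq> {}"
  proof -
    obtain t0 where "t0 \<in> T" using fin by blast
    then have "(\<lambda>t. if t = t0 then 1 else 0) \<in> S"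
      using fin by (auto simp: S_def box_def split: if_splits)
    then show ?thesis by blast
  qed
  moreover define m where "m w j = (\<Sum>t\<in>T. w t * e t j)" for w j
  \<comment> \<open>At a minimiser \<open>w\<close> of \<open>Q\<close>, the residual is itself the separating functional.\<close>
  define Q where "Q w = (\<Sum>j\<in>J. (m w j - v j)\<^sup>2)" for w
  have "continuous_on S Q"
    unfolding Q_def m_def
    by (intro continuous_intros continuous_on_subset[OF continuous_on_product_coordinates subset_UNIV])
  ultimately obtain w where w: "w \<in> S" and min: "\<And>w'. w' \<in> S \<Longrightarrow> Q w \<le> Q w'"
    using continuous_attains_inf by metis
  have w01: "w s \<in> (if s \<in> T then {0..1} else {0})" for s
    using w unfolding S_def box_def by (blast dest: PiE_mem[OF _ UNIV_I])
  define f where "f j = m w j - v j" for j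
  have dir: "(\<Sum>j\<in>J. m w j * f j) \<le> (\<Sum>j\<in>J. e t j * f j)" if t: "t \<in> T" for t
  proof (rule ccontr)
    assume neg: "\<not> ?thesis"
    define D where "D = (\<Sum>j\<in>J. (e t j - m w j) * f j)"
    define R where "R = (\<Sum>j\<in>J. (e t j - m w j)\<^sup>2)"
    have D: "D < 0" using neg unfolding D_def by (simp add: left_diff_distrib sum_subtractf)
    have R: "R \<ge> 0" unfolding R_def by (intro sum_nonneg) simp
    \<comment> \<open>Moving from \<open>w\<close> towards the vertex \<open>t\<close> by \<epsilon>
      changes \<open>Q\<close> by \<epsilon> (2 D + \<epsilon> R). This choice makes \<epsilon> R
      \<le> - D, hence a strict decrease; the 1 in the denominator covers R = 0.\<close>
    define \<epsilon> where "\<epsilon> = min 1 (- D / (R + 1))"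
    have \<epsilon>: "0 < \<epsilon>" "\<epsilon> \<le> 1" "\<epsilon> \<le> - D / (R + 1)"
      using D R by (simp_all add: \<epsilon>_def divide_neg_pos)
    define w' where "w' s = (1 - \<epsilon>) * w s + \<epsilon> * (if s = t then 1 else 0)" for s
    have "w' s \<in> (if s \<in> T then {0..1} else {0})" for s
    proof (cases "s \<in> T")
      case True
      then have "0 \<le> w s" "w s \<le> 1" using w01[of s] by auto
      moreover have "(1 - \<epsilon>) * w s + \<epsilon> * (if s = t then 1 else 0) \<le> (1 - \<epsilon>) * 1 + \<epsilon> * 1"
        using \<open>w s \<le> 1\<close> \<epsilon> by (intro add_mono mult_left_mono) auto
      ultimately show ?thesis using True \<epsilon> unfolding w'_def by auto
    next
      case False
      then show ?thesis using w01[of s] t unfolding w'_def by auto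
    qed
    moreover have "(\<Sum>s\<in>T. w' s) = 1"
    proof -
      have "(\<Sum>s\<in>T. w' s) = (1 - \<epsilon>) * (\<Sum>s\<in>T. w s) + \<epsilon> * (\<Sum>s\<in>T. if s = t then 1 else 0)"
        unfolding w'_def by (simp only: sum.distrib sum_distrib_left)
      then show ?thesis using w fin t unfolding S_def by simp
    qed
    ultimately have "w' \<in> S" unfolding S_def box_def by (auto simp: PiE_iff)
    have mw': "m w' j = m w j + \<epsilon> * (e t j - m w j)" for j
    proof -
      have "m w' j = (1 - \<epsilon>) * m w j + \<epsilon> * (\<Sum>s\<in>T. if s = t then e t j else 0)"
        unfolding w'_def m_def sum_distrib_left sum.distrib[symmetric]
        by (intro sum.cong) (auto simp: algebra_simps)
      then show ?thesis using fin t by (simp add: algebra_simps)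
    qed
    have "Q w' = Q w + \<epsilon> * (2 * D + \<epsilon> * R)"
      unfolding Q_def D_def R_def mw' sum_distrib_left sum.distrib[symmetric] f_def
      by (intro sum.cong refl) (simp add: power2_eq_square algebra_simps)
    with min[OF \<open>w' \<in> S\<close>] \<epsilon> have "2 * D + \<epsilon> * R \<ge> 0" by (simp add: zero_le_mult_iff)
    moreover have "\<epsilon> * R \<le> - D"
    proof -
      have "\<epsilon> * (R + 1) \<le> - D"
        by (rule iffD1[OF pos_le_divide_eq \<epsilon>(3)]) (use R in auto)
      then show ?thesis using \<epsilon> unfolding distrib_left by linarith
    qed
    ultimately show False using D by linarith
  qed
  \<comment> \<open>Here \<open>sep\<close> is used with \<open>c\<close> the value of the residual
    functional at the minimiser; the two sides differ by the squared residual.\<close>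
  have "(\<Sum>j\<in>J. m w j * f j) \<le> (\<Sum>j\<in>J. v j * f j)"
    using dir by (rule sep)
  then have "(\<Sum>j\<in>J. (f j)\<^sup>2) \<le> 0"
    by (simp add: f_def power2_eq_square left_diff_distrib sum_subtractf)
  then have "f j = 0" if "j \<in> J" for j
    using that fin by (metis (no_types, lifting) sum_nonneg_eq_0_iff antisym sum_nonneg zero_le_power2 zero_eq_power2)
  then have "(\<Sum>t\<in>T. w t * e t j) = v j" if "j \<in> J" for j
    using that by (force simp: f_def m_def)
  moreover have "w t \<ge> 0" if "t \<in> T" for t
    using w01[of t] that by simp
  moreover have "(\<Sum>t\<in>T. w t) = 1" using w unfolding S_def by simp
  ultimately show ?thesis using that by blast
qed

section \<open>The parameter rho\<close>

text \<open>Split 3j - n = (2j - n) + j. Under j to n - j the first part symmetrises to products of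
  factors of equal sign, and the second part is positive. Besides the sign at 1, this forces \<rho>
  < 1.\<close>

lemma centered_power_sum_pos:
  fixes r :: real
  assumes r: "r \<ge> 1" and n: "n > 0"
  shows "(\<Sum>j\<le>n. (3 * real j - real n) * r ^ j) > 0"
proof -
  have rev: "(\<Sum>j\<le>n. (2 * real j - real n) * r ^ j) = (\<Sum>j\<le>n. (real n - 2 * real j) * r ^ (n - j))"
    by (rule sum.reindex_bij_witness[of _ "\<lambda>j. n - j" "\<lambda>j. n - j"]) auto
  have "0 \<le> (\<Sum>j\<le>n. (2 * real j - real n) * (r ^ j - r ^ (n - j)))"
  proof (intro sum_nonneg)
    fix j assume "j \<in> {..n}"
    show "0 \<le> (2 * real j - real n) * (r ^ j - r ^ (n - j))"
    proof (cases "n \<le> 2 * j")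
      case True
      then show ?thesis using r \<open>j \<in> {..n}\<close> by (intro mult_nonneg_nonneg) (auto intro: power_increasing)
    next
      case False
      then show ?thesis using r by (intro mult_nonpos_nonpos) (auto intro: power_increasing)
    qed
  qed
  also have "\<dots> = 2 * (\<Sum>j\<le>n. (2 * real j - real n) * r ^ j)"
    using rev by (simp add: algebra_simps sum_subtractf sum.distrib)
  finally have 1: "0 \<le> (\<Sum>j\<le>n. (2 * real j - real n) * r ^ j)" by simp
  have "0 < real n * r ^ n" using r n by simp
  also have "\<dots> \<le> (\<Sum>j\<le>n. real j * r ^ j)"
    using r by (intro member_le_sum[of n _ "\<lambda>j. real j * r ^ j"]) auto
  finally have 2: "0 < (\<Sum>j\<le>n. real j * r ^ j)" .
  have "(\<Sum>j\<le>n. (3 * real j - real n) * r ^ j)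
      = (\<Sum>j\<le>n. (2 * real j - real n) * r ^ j) + (\<Sum>j\<le>n. real j * r ^ j)"
    unfolding sum.distrib[symmetric] by (intro sum.cong refl) (simp add: algebra_simps)
  then show ?thesis using 1 2 by linarith
qed

lemma centered_power_sum_scale_pos:
  fixes r s :: real
  assumes r: "0 < r" "r < s" and n: "n > 0" and zero: "(\<Sum>j\<le>n. (3 * real j - real n) * r ^ j) = 0"
  shows "(\<Sum>j\<le>n. (3 * real j - real n) * s ^ j) > 0"
proof -
  \<comment> \<open>Scaling by \<open>u^3\<close> makes the exponents \<open>3 * j\<close> comparable with \<open>n\<close>, so every term has a sign.\<close>
  define u where "u = root 3 (s / r)"
  have u: "u > 1" "s = r * u ^ 3"
    using r by (auto simp: u_def)
  have s_pow: "s ^ j = r ^ j * u ^ (3 * j)" for j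
    by (simp add: u(2) power_mult_distrib power_mult)
  have "0 < (\<Sum>j\<le>n. (3 * real j - real n) * r ^ j * (u ^ (3 * j) - u ^ n))"
  proof (rule sum_pos2[of _ 0])
    show "0 < (3 * real 0 - real n) * r ^ 0 * (u ^ (3 * 0) - u ^ n)"
      using u n one_less_power[of u n] by (simp add: mult_pos_neg)
    fix j assume "j \<in> {..n}"
    show "0 \<le> (3 * real j - real n) * r ^ j * (u ^ (3 * j) - u ^ n)"
    proof (cases "n \<le> 3 * j")
      case True
      then show ?thesis using r u by (intro mult_nonneg_nonneg) (auto intro: power_increasing)
    next
      case False
      then show ?thesis using r u
        by (intro mult_nonpos_nonpos mult_nonpos_nonneg) (auto intro: power_increasing)
    qed
  qed auto
  \<comment> \<open>The term with \<open>u ^ n\<close> costs nothing: it multiplies the sum that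
    vanishes at \<open>r\<close>.\<close>
  also have "\<dots> = (\<Sum>j\<le>n. (3 * real j - real n) * s ^ j)
      - u ^ n * (\<Sum>j\<le>n. (3 * real j - real n) * r ^ j)"
    unfolding sum_distrib_left sum_subtractf[symmetric] s_pow
    by (intro sum.cong refl) (simp add: algebra_simps)
  finally show ?thesis using zero by simp
qed

lemma centered_power_sum_root:
  assumes "n > 0"
  shows "\<exists>!r::real. r > 0 \<and> (\<Sum>j\<le>n. (3 * real j - real n) * r ^ j) = 0"
proof -
  define D where "D r = (\<Sum>j\<le>n. (3 * real j - real n) * r ^ j)" for r :: real
  have "D 0 = - real n"
    unfolding D_def by (subst sum.atMost_shift) simp
  moreover have "D 1 > 0" unfolding D_def using assms by (intro centered_power_sum_pos) auto
  moreover have "continuous_on {0..1} D" unfolding D_def by (intro continuous_intros)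
  ultimately obtain r where r: "0 \<le> r" "D r = 0" using IVT'[of D 0 0 1] assms by force
  have "r \<noteq> 0" using r \<open>D 0 = - real n\<close> assms by auto
  with r have "r > 0" by simp
  moreover have False if "0 < r" "r < s" "D r = 0" "D s = 0" for r s
    using centered_power_sum_scale_pos[of r s n] that assms unfolding D_def by simp
  ultimately show ?thesis using r unfolding D_def[symmetric]
    by (metis linorder_neqE_linordered_idom)
qed

section \<open>From the dual inequality to the coupling\<close>

text \<open>Separation yields weights on triples for which only the average of the three marginals
  is \<open>\<pi>\<close>. Averaging over cyclic rotations, which preserve the sum, makes each
  marginal equal to \<open>\<pi>\<close>.\<close>

lemma Delta_if_dual_nonneg:
  assumes supp: "set_pmf \<pi> \<subseteq> {..n}"
    and dual: "\<And>f :: nat \<Rightarrow> real. (\<And>a b c. a + b + c = n \<Longrightarrow> f a + f b + f c \<ge> 0) \<Longrightarrow>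
      (\<Sum>j\<le>n. pmf \<pi> j * f j) \<ge> 0"
  shows "\<pi> \<in> Delta (Suc n)"
proof -
  define T where "T = {(a, b, c). a + b + c = n}"
  have "T \<subseteq> {..n} \<times> {..n} \<times> {..n}" unfolding T_def by auto
  then have finT: "finite T" by (rule finite_subset) simp
  have "(n, 0, 0) \<in> T" by (simp add: T_def)
  then have neT: "T \<noteq> {}" by blast
  have pmf_sum: "(\<Sum>j\<le>n. pmf \<pi> j) = 1" using supp by (intro sum_pmf_eq_1) auto
  define e :: "nat \<times> nat \<times> nat \<Rightarrow> nat \<Rightarrow> real" where
    "e = (\<lambda>(a, b, c) j. (of_bool (a = j) + of_bool (b = j) + of_bool (c = j)) / 3)"
  have pick: "(\<Sum>j\<le>n. of_bool (a = j) * f j) = f a" if "a \<le> n" for a and f :: "nat \<Rightarrow> real"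
    using that by (simp add: of_bool_def if_distrib[of "\<lambda>x. x * _"] cong: if_cong)
  have e_sum: "(\<Sum>j\<le>n. e (a, b, c) j * f j) = (f a + f b + f c) / 3"
    if "a + b + c = n" for a b c and f :: "nat \<Rightarrow> real"
  proof -
    have "(\<Sum>j\<le>n. e (a, b, c) j * f j) = ((\<Sum>j\<le>n. of_bool (a = j) * f j)
        + (\<Sum>j\<le>n. of_bool (b = j) * f j) + (\<Sum>j\<le>n. of_bool (c = j) * f j)) / 3"
      unfolding e_def sum.distrib[symmetric] sum_divide_distrib
      by (intro sum.cong refl) (simp add: field_simps)
    then show ?thesis using that by (simp only: pick)
  qed
  obtain w where w: "\<And>t. t \<in> T \<Longrightarrow> w t \<ge> 0" "(\<Sum>t\<in>T. w t) = 1"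
    and marg: "\<And>j. j \<in> {..n} \<Longrightarrow> (\<Sum>t\<in>T. w t * e t j) = pmf \<pi> j"
  proof (rule convex_combination_if_not_separated[OF finT neT, of "{..n}" e "pmf \<pi>"])
    fix f c assume *: "\<And>t. t \<in> T \<Longrightarrow> c \<le> (\<Sum>j\<in>{..n}. e t j * f j)"
    \<comment> \<open>The dual hypothesis is homogeneous, so the constant is absorbed into the test
      function; it comes back because \<open>\<pi>\<close> has mass 1.\<close>
    have "(\<Sum>j\<le>n. pmf \<pi> j * (f j - c)) \<ge> 0"
    proof (rule dual)
      fix a b d assume "a + b + d = n"
      then show "f a - c + (f b - c) + (f d - c) \<ge> 0"
        using *[of "(a, b, d)"] e_sum[of a b d f] by (simp add: T_def)
    qed
    then have "c * (\<Sum>j\<le>n. pmf \<pi> j) \<le> (\<Sum>j\<le>n. pmf \<pi> j * f j)"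
      by (simp add: right_diff_distrib sum_subtractf sum_distrib_left mult.commute)
    then show "c \<le> (\<Sum>j\<in>{..n}. pmf \<pi> j * f j)" using pmf_sum by simp
  qed auto
  define rot :: "nat \<times> nat \<times> nat \<Rightarrow> nat \<times> nat \<times> nat" where "rot = (\<lambda>(a, b, c). (b, c, a))"
  have rot3: "rot (rot (rot t)) = t" for t by (auto simp: rot_def split: prod.splits)
  have rotT: "rot t \<in> T \<longleftrightarrow> t \<in> T" for t by (auto simp: rot_def T_def split: prod.splits)
  have reindex: "(\<Sum>t\<in>T. g (rot t)) = (\<Sum>t\<in>T. g t)" for g :: "_ \<Rightarrow> real"
    by (rule sum.reindex_bij_witness[of _ "\<lambda>t. rot (rot t)" rot]) (auto simp: rot3 rotT)
  define v where "v t = (if t \<in> T then (w t + w (rot t) + w (rot (rot t))) / 3 else 0)" for t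
  have v_nonneg: "v t \<ge> 0" for t using w(1) by (auto simp: v_def rotT)
  have v_sum: "(\<Sum>t\<in>T. u t * v t) = (\<Sum>t\<in>T. w t * ((u t + u (rot t) + u (rot (rot t))) / 3))"
    for u :: "_ \<Rightarrow> real"
  proof -
    have "(\<Sum>t\<in>T. u t * v t) = ((\<Sum>t\<in>T. w t * u t) + (\<Sum>t\<in>T. w (rot t) * u t)
        + (\<Sum>t\<in>T. w (rot (rot t)) * u t)) / 3"
      unfolding v_def sum.distrib[symmetric] sum_divide_distrib
      by (intro sum.cong refl) (simp add: field_simps)
    also have "(\<Sum>t\<in>T. w (rot t) * u t) = (\<Sum>t\<in>T. w t * u (rot (rot t)))"
      using reindex[of "\<lambda>t. w t * u (rot (rot t))"] by (simp add: rot3)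
    also have "(\<Sum>t\<in>T. w (rot (rot t)) * u t) = (\<Sum>t\<in>T. w t * u (rot t))"
      using reindex[of "\<lambda>t. w (rot (rot t)) * u t", symmetric]
      reindex[of "\<lambda>t. w (rot (rot t)) * u t"] by (simp add: rot3)
    finally show ?thesis
      unfolding sum.distrib[symmetric] sum_divide_distrib
      by (simp add: field_simps sum.distrib sum_distrib_left)
  qed
  have total: "(\<integral>\<^sup>+ t. ennreal (v t) \<partial>count_space UNIV) = 1"
  proof -
    have "(\<integral>\<^sup>+ t. ennreal (v t) \<partial>count_space UNIV) = (\<integral>\<^sup>+ t. ennreal (v t) \<partial>count_space T)"
      by (intro nn_integral_count_space_eq) (auto simp: v_def)
    also have "\<dots> = ennreal (\<Sum>t\<in>T. v t)"
      using finT v_nonneg by (simp add: nn_integral_count_space_finite)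
    also have "(\<Sum>t\<in>T. v t) = 1" using v_sum[of "\<lambda>_. 1"] w(2) by simp
    finally show ?thesis by simp
  qed
  define V where "V = embed_pmf v"
  have pmfV: "pmf V t = v t" for t
    unfolding V_def by (rule pmf_embed_pmf[OF v_nonneg total])
  have setV: "t \<in> T" if "t \<in> set_pmf V" for t
    using that pmfV by (auto simp: set_pmf_iff v_def split: if_splits)
  \<comment> \<open>The premise says that \<open>X\<close> along the three rotations of
    \<open>t\<close> reads off all three coordinates, which holds for each coordinate
    projection.\<close>
  have law: "map_pmf X V = \<pi>"
    if X: "\<And>t j. (of_bool (X t = j) + of_bool (X (rot t) = j) + of_bool (X (rot (rot t)) = j)) / 3 = e t j"
    for X
  proof (rule pmf_eqI)
    fix j
    have "pmf (map_pmf X V) j = measure_pmf.expectation V (indicator (X -` {j}))"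
      by (simp add: pmf_map)
    also have "\<dots> = (\<Sum>t\<in>T. indicator (X -` {j}) t * pmf V t)"
      by (rule integral_measure_pmf_real[OF finT]) (use setV in auto)
    also have "\<dots> = (\<Sum>t\<in>T. of_bool (X t = j) * v t)"
      by (intro sum.cong refl) (simp add: pmfV indicator_def)
    also have "\<dots> = (\<Sum>t\<in>T. w t * e t j)"
      unfolding v_sum X ..
    also have "\<dots> = pmf \<pi> j"
    proof (cases "j \<le> n")
      case False
      then have "pmf \<pi> j = 0" using supp by (auto simp: pmf_eq_0_set_pmf)
      moreover have "e t j = 0" if "t \<in> T" for t using that False by (auto simp: T_def e_def)
      ultimately show ?thesis by simp
    qed (simp add: marg)
    finally show "pmf (map_pmf X V) j = pmf \<pi> j" .
  qed
  have laws: "map_pmf X V = \<pi>" if "X \<in> {fst, fst \<circ> snd, snd \<circ> snd}" for X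
    using that by (intro law) (auto simp: rot_def e_def split: prod.splits)
  show ?thesis
  proof (rule Delta_I[of \<pi> "Suc n" "measure_pmf V" fst "fst \<circ> snd" "snd \<circ> snd"])
    show "set_pmf \<pi> \<subseteq> {..<Suc n}" using supp by auto
    show "distr (measure_pmf V) (count_space UNIV) X = measure_pmf \<pi>"
      if "X \<in> {fst, fst \<circ> snd, snd \<circ> snd}" for X
      using laws[OF that] by (simp add: map_pmf_rep_eq[symmetric])
    show "AE \<omega> in measure_pmf V. fst \<omega> + (fst \<circ> snd) \<omega> + (snd \<circ> snd) \<omega> = Suc n - 1"
      using setV by (auto simp: AE_measure_pmf_iff T_def)
  qed (auto simp: measure_pmf.prob_space_axioms)
qed

lemma expectation_psi_eq_third_iff:
  assumes "\<rho> > 0"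
  shows "measure_pmf.expectation (psi (Suc n) \<rho>) real = real n / 3 \<longleftrightarrow>
    (\<Sum>j\<le>n. (3 * real j - real n) * \<rho> ^ j) = 0"
proof -
  define Z where "Z = (\<Sum>j\<le>n. \<rho> ^ j)"
  have Z: "Z > 0" unfolding Z_def using assms by (intro sum_pos) auto
  have pmf: "pmf (psi (Suc n) \<rho>) j = (if j \<le> n then \<rho> ^ j / Z else 0)" for j
    using pmf_psi[OF assms, of "Suc n" j] by (simp add: Z_def lessThan_Suc_atMost less_Suc_eq_le)
  have "measure_pmf.expectation (psi (Suc n) \<rho>) real = (\<Sum>j\<le>n. real j * pmf (psi (Suc n) \<rho>) j)"
    by (rule integral_measure_pmf_real) (auto simp: set_pmf_iff pmf split: if_splits)
  also have "\<dots> = (\<Sum>j\<le>n. real j * \<rho> ^ j) / Z"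
    by (simp add: pmf sum_divide_distrib)
  finally have "measure_pmf.expectation (psi (Suc n) \<rho>) real = (\<Sum>j\<le>n. real j * \<rho> ^ j) / Z" .
  moreover have "(\<Sum>j\<le>n. (3 * real j - real n) * \<rho> ^ j) = 3 * (\<Sum>j\<le>n. real j * \<rho> ^ j) - real n * Z"
    by (simp add: Z_def left_diff_distrib sum_subtractf sum_distrib_left mult.assoc)
  moreover have "M / Z = real n / 3 \<longleftrightarrow> 3 * M - real n * Z = 0" for M
    using Z by (auto simp: field_simps)
  ultimately show ?thesis by simp
qed

lemma psi_in_Delta:
  assumes "\<rho> > 0" "n > 0" and root: "(\<Sum>j\<le>n. (3 * real j - real n) * \<rho> ^ j) = 0"
  shows "psi (Suc n) \<rho> \<in> Delta (Suc n)"
proof (rule Delta_if_dual_nonneg)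
  define Z where "Z = (\<Sum>j\<le>n. \<rho> ^ j)"
  have Z: "Z > 0" unfolding Z_def using assms by (intro sum_pos) auto
  have pmf: "pmf (psi (Suc n) \<rho>) j = (if j \<le> n then \<rho> ^ j / Z else 0)" for j
    using pmf_psi[OF assms(1), of "Suc n" j] by (simp add: Z_def lessThan_Suc_atMost less_Suc_eq_le)
  show "set_pmf (psi (Suc n) \<rho>) \<subseteq> {..n}"
    by (auto simp: set_pmf_iff pmf split: if_splits)
  \<comment> \<open>For \<rho> \<ge> 1 the centered sum would be positive; this is what makes the
    weights decreasing.\<close>
  have "\<rho> < 1"
    using centered_power_sum_pos[of \<rho> n] assms by (cases "\<rho> < 1") auto
  fix f :: "nat \<Rightarrow> real" assume f: "\<And>a b c. a + b + c = n \<Longrightarrow> f a + f b + f c \<ge> 0"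
  have "(\<Sum>j\<le>n. \<rho> ^ j * f j) \<ge> 0"
  proof (rule decreasing_pairing_nonneg[OF _ _ \<open>n > 0\<close>])
    show "\<rho> ^ Suc k \<le> \<rho> ^ k" for k
      using assms(1) \<open>\<rho> < 1\<close> by (intro power_decreasing) auto
    show "(\<Sum>j\<le>n. \<rho> ^ j * (3 * real j - real n)) = 0"
      using root by (simp add: mult.commute)
  qed (use assms f in auto)
  moreover have "(\<Sum>j\<le>n. pmf (psi (Suc n) \<rho>) j * f j) = (\<Sum>j\<le>n. \<rho> ^ j * f j) / Z"
    by (simp add: pmf sum_divide_distrib)
  ultimately show "(\<Sum>j\<le>n. pmf (psi (Suc n) \<rho>) j * f j) \<ge> 0" using Z by simp
qed

theorem mainTheorem2:
  fixes p :: nat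
  assumes "p \<ge> 2"
  shows "(\<exists>!\<rho>::real. \<rho> > 0 \<and>
            measure_pmf.expectation (psi p \<rho>) real = (real p - 1) / 3) \<and>
         (\<forall>\<rho>::real. \<rho> > 0 \<and>
            measure_pmf.expectation (psi p \<rho>) real = (real p - 1) / 3 \<longrightarrow>
            psi p \<rho> \<in> Delta p)"
proof -
  define n where "n = p - 1"
  have n: "n > 0" and p: "p = Suc n" "real p - 1 = real n" using assms by (auto simp: n_def)
  have eq: "\<rho> > 0 \<and> measure_pmf.expectation (psi p \<rho>) real = (real p - 1) / 3 \<longleftrightarrow>
      \<rho> > 0 \<and> (\<Sum>j\<le>n. (3 * real j - real n) * \<rho> ^ j) = 0" for \<rho>
    unfolding p(2) unfolding p(1) using expectation_psi_eq_third_iff by blast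
  show ?thesis
    unfolding eq using centered_power_sum_root[OF n] psi_in_Delta n unfolding p(1) by blast
qed

end
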